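(* There exist a zero-dimensional compact metric space $X$, a countable group $G$ that is not finitely generated, and a continuous action of $G$ on $X$ that is minimal and distal but not equicontinuous.
   Context: $G$ is regarded as a discrete group. A continuous action $(X,G)$ of $G$ on a compact metric space $(X,d)$ is a group homomorphism $\phi\colon G\to \mathrm{Homeo}(X)$; write $gx=\phi(g)(x)$. The action is minimal if $X$ has no proper nonempty $G$-invariant closed subset (equivalently, every orbit $Gx$ is dense in $X$). The action is distal if $\inf_{g\in G} d(gx,gy)>0$ for all $x\neq y$ in $X$. The action is equicontinuous if for every $\varepsilon>0$ there exists $\delta>0$ such that $\sup_{g\in G} d(gx,gy)<\varepsilon$ for all $x,y\in X$ with $d(x,y)<\delta$. *)

theory Defs
  imports "HOL-Analysis.Analysis" "HOL-Algebra.Bij" "HOL-Algebra.Generated_Groups"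
begin

text \<open>\<open>T dim_le 0\<close> says that \<open>T\<close> has a base of clopen sets, see
  \<open>dimension_le_0_neighbourhood_base_of_clopen\<close>.\<close>

definition zero_dimensional :: "'a topology \<Rightarrow> bool"
  where "zero_dimensional T \<longleftrightarrow> topspace T \<noteq> {} \<and> T dim_le 0"

definition finitely_generated_group :: "('g, 'm) monoid_scheme \<Rightarrow> bool"
  where "finitely_generated_group G \<longleftrightarrow>
    (\<exists>S. finite S \<and> S \<subseteq> carrier G \<and> generate G S = carrier G)"

text \<open>As in \<^const>\<open>BijGroup\<close>, the elements are normalised to be \<^const>\<open>undefined\<close> outside
  the space, so that equality of homeomorphisms is equality on the space.\<close>

definition HomeoGroup :: "'a topology \<Rightarrow> ('a \<Rightarrow> 'a) monoid"
  where "HomeoGroup T =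
    (BijGroup (topspace T))\<lparr>carrier := {f \<in> Bij (topspace T). homeomorphic_map T T f}\<rparr>"

lemma group_HomeoGroup: "group (HomeoGroup T)"
proof -
  let ?S = "topspace T"
  interpret B: group "BijGroup ?S" by (rule group_BijGroup)
  have "subgroup {f \<in> Bij ?S. homeomorphic_map T T f} (BijGroup ?S)"
  proof (rule B.subgroupI)
    show "{f \<in> Bij ?S. homeomorphic_map T T f} \<subseteq> carrier (BijGroup ?S)"
      by (auto simp: BijGroup_def)
    have "homeomorphic_map T T (\<lambda>x\<in>?S. x)"
      by (rule homeomorphic_map_eq[of _ _ id]) auto
    then show "{f \<in> Bij ?S. homeomorphic_map T T f} \<noteq> {}"
      using id_Bij by blast
  next
    fix f assume "f \<in> {f \<in> Bij ?S. homeomorphic_map T T f}"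
    then have f: "f \<in> Bij ?S" and h: "homeomorphic_map T T f" by auto
    obtain g where g: "homeomorphic_maps T T f g"
      using h homeomorphic_map_maps by blast
    then have gh: "homeomorphic_map T T g"
      using homeomorphic_maps_map by blast
    have eq: "g x = (\<lambda>x\<in>?S. inv_into ?S f x) x" if x: "x \<in> ?S" for x
    proof -
      have "g x \<in> ?S" "f (g x) = x"
        using g x by (auto simp: homeomorphic_maps_def continuous_map_def)
      then have "inv_into ?S f x = g x"
        using f by (metis Bij_def IntD2 bij_betw_def inv_into_f_eq mem_Collect_eq)
      then show ?thesis using x by simp
    qed
    have "homeomorphic_map T T (\<lambda>x\<in>?S. inv_into ?S f x)"
      by (rule homeomorphic_map_eq[OF gh eq])
    then show "inv\<^bsub>BijGroup ?S\<^esub> f \<in> {f \<in> Bij ?S. homeomorphic_map T T f}"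
      using f by (auto simp: inv_BijGroup restrict_inv_into_Bij)
  next
    fix f g assume "f \<in> {f \<in> Bij ?S. homeomorphic_map T T f}"
      and "g \<in> {f \<in> Bij ?S. homeomorphic_map T T f}"
    then have fg: "f \<in> Bij ?S" "g \<in> Bij ?S" and "homeomorphic_map T T (f \<circ> g)"
      by (auto intro: homeomorphic_map_compose)
    then have "homeomorphic_map T T (compose ?S f g)"
      by (rule_tac homeomorphic_map_eq[of _ _ "f \<circ> g"]) (auto simp: compose_def)
    then show "f \<otimes>\<^bsub>BijGroup ?S\<^esub> g \<in> {f \<in> Bij ?S. homeomorphic_map T T f}"
      using fg by (auto simp: BijGroup_def compose_Bij)
  qed
  then show ?thesis
    unfolding HomeoGroup_def by (rule B.subgroup_imp_group)
qed

definition continuous_action ::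
    "('g, 'm) monoid_scheme \<Rightarrow> 'a topology \<Rightarrow> ('g \<Rightarrow> 'a \<Rightarrow> 'a) \<Rightarrow> bool"
  where "continuous_action G T \<phi> \<longleftrightarrow> group G \<and> \<phi> \<in> hom G (HomeoGroup T)"

definition minimal_action ::
    "('g, 'm) monoid_scheme \<Rightarrow> 'a topology \<Rightarrow> ('g \<Rightarrow> 'a \<Rightarrow> 'a) \<Rightarrow> bool"
  where "minimal_action G T \<phi> \<longleftrightarrow>
    \<not> (\<exists>C. closedin T C \<and> C \<noteq> {} \<and> C \<noteq> topspace T \<and> (\<forall>g\<in>carrier G. \<phi> g ` C \<subseteq> C))"

text \<open>The infimum and supremum below are taken in \<^typ>\<open>real\<close>. For a group acting on a compact
  metric space the sets in question are nonempty and bounded, so they have their usual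
  meaning.\<close>

definition distal_action ::
    "('g, 'm) monoid_scheme \<Rightarrow> 'a set \<Rightarrow> ('a \<Rightarrow> 'a \<Rightarrow> real) \<Rightarrow> ('g \<Rightarrow> 'a \<Rightarrow> 'a) \<Rightarrow> bool"
  where "distal_action G M d \<phi> \<longleftrightarrow>
    (\<forall>x\<in>M. \<forall>y\<in>M. x \<noteq> y \<longrightarrow> (INF g\<in>carrier G. d (\<phi> g x) (\<phi> g y)) > 0)"

definition equicontinuous_action ::
    "('g, 'm) monoid_scheme \<Rightarrow> 'a set \<Rightarrow> ('a \<Rightarrow> 'a \<Rightarrow> real) \<Rightarrow> ('g \<Rightarrow> 'a \<Rightarrow> 'a) \<Rightarrow> bool"
  where "equicontinuous_action G M d \<phi> \<longleftrightarrow>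
    (\<forall>\<epsilon>>0. \<exists>\<delta>>0. \<forall>x\<in>M. \<forall>y\<in>M. d x y < \<delta> \<longrightarrow>
      (SUP g\<in>carrier G. d (\<phi> g x) (\<phi> g y)) < \<epsilon>)"

text \<open>HOL cannot quantify over types inside a formula, so existence statements fix the types of
  the points and of the group elements. A compact metric space has at most continuum many points
  and hence an isometric copy with some subset of \<^typ>\<open>nat \<Rightarrow> bool\<close> as point set (the
  metric is unrelated to any structure on that type); a countable group has an isomorphic copy with
  carrier in \<^typ>\<open>nat\<close>. So nothing is lost by these choices.\<close>

type_synonym point = "nat \<Rightarrow> bool"

end

theory Submission
  imports Defs "HOL-Algebra.Weak_Morphisms"
begin

text \<open>Split a point of the Cantor space \<open>{0,1}\<^sup>\<nat>\<close> into its coordinate \<open>0\<close>, the fibre, and the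
  remaining coordinates, the base. The group consists of the skew products that translate the base
  by a finitely supported sequence and the fibre by a clopen function of the base.
  Base differences are invariant, and so is the fibre difference of two points over the same base
  point; hence the action is distal. Two distinct base points, however close, are separated by some
  clopen set, and the corresponding skew product moves their fibre coordinates apart; hence the
  action is not equicontinuous. Finitely many group elements change only finitely many base
  coordinates, hence they do not generate the group.\<close>

section \<open>The Cantor space with the first-difference metric\<close>

definition diff_dist :: "point \<Rightarrow> point \<Rightarrow> real"
  where "diff_dist x y = (if x = y then 0 else inverse (real (Suc (LEAST n. x n \<noteq> y n))))"

definition cylinder :: "nat \<Rightarrow> point \<Rightarrow> point set"
  where "cylinder N x = {y. \<forall>i<N. y i = x i}"

lemma cylinder_antimono: "M \<le> N \<Longrightarrow> cylinder N x \<subseteq> cylinder M x"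
  by (auto simp: cylinder_def)

text \<open>If \<open>k\<close> is the first index of disagreement, the distance is 1/(k+1), so the
  inequality means \<open>N < k\<close>: agreement on 0, ..., N. That is why the cylinder has length
  \<open>Suc N\<close>.\<close>

lemma diff_dist_less_iff:
  "diff_dist x y < inverse (real (Suc N)) \<longleftrightarrow> y \<in> cylinder (Suc N) x"
proof (cases "x = y")
  case True
  then show ?thesis by (simp add: diff_dist_def cylinder_def)
next
  case False
  then obtain n where n: "x n \<noteq> y n" by blast
  define k where "k = (LEAST n. x n \<noteq> y n)"
  have k: "x k \<noteq> y k" and less: "\<And>i. i < k \<Longrightarrow> x i = y i"
    unfolding k_def using LeastI[of "\<lambda>n. x n \<noteq> y n", OF n] not_less_Least by blast+
  have "diff_dist x y < inverse (real (Suc N)) \<longleftrightarrow> N < k"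
    using False by (simp add: diff_dist_def k_def)
  also have "\<dots> \<longleftrightarrow> y \<in> cylinder (Suc N) x"
    unfolding cylinder_def mem_Collect_eq
    by (metis k less less_Suc_eq_le not_less order_le_less_trans)
  finally show ?thesis .
qed

lemma diff_dist_ge:
  assumes "x n \<noteq> y n"
  shows "inverse (real (Suc n)) \<le> diff_dist x y"
  using diff_dist_less_iff[of x y n] assms by (force simp: cylinder_def)

lemma diff_dist_le_1: "diff_dist x y \<le> 1"
  by (simp add: diff_dist_def inverse_le_1_iff)

lemma diff_dist_commute: "diff_dist x y = diff_dist y x"
proof -
  have "(\<lambda>n. x n \<noteq> y n) = (\<lambda>n. y n \<noteq> x n)" by auto
  then show ?thesis by (simp add: diff_dist_def)
qed

text \<open>At the first index where \<open>x\<close> and \<open>z\<close> differ, \<open>y\<close>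
  must differ from one of them, so that one of the two distances is at least as large.\<close>

lemma diff_dist_ultrametric: "diff_dist x z \<le> max (diff_dist x y) (diff_dist y z)"
proof (cases "x = z")
  case True
  then show ?thesis by (simp add: diff_dist_def le_max_iff_disj)
next
  case False
  then obtain n where n: "x n \<noteq> z n" by blast
  define k where "k = (LEAST n. x n \<noteq> z n)"
  have k: "x k \<noteq> z k"
    unfolding k_def using n by (rule LeastI)
  have "diff_dist x z = inverse (real (Suc k))"
    using False by (simp add: diff_dist_def k_def)
  moreover have "x k \<noteq> y k \<or> y k \<noteq> z k" using k by auto
  ultimately show ?thesis using diff_dist_ge[of x k y] diff_dist_ge[of y k z] by linarith
qed

interpretation cantor: Metric_space UNIV diff_dist
proof
  show nonneg: "0 \<le> diff_dist x y" for x y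
    by (simp add: diff_dist_def)
  show "diff_dist x y = diff_dist y x" for x y
    by (rule diff_dist_commute)
  show "diff_dist x y = 0 \<longleftrightarrow> x = y" for x y
    by (simp add: diff_dist_def)
  show "diff_dist x z \<le> diff_dist x y + diff_dist y z" for x y z
    using diff_dist_ultrametric[of x z y] nonneg[of x y] nonneg[of y z] by linarith
qed

text \<open>Balls of radius 1/(N+1) are cylinders, and these radii become arbitrarily small. From
  here on cylinders replace balls in topological arguments.\<close>

lemma openin_cantor_iff: "openin cantor.mtopology U \<longleftrightarrow> (\<forall>x\<in>U. \<exists>N. cylinder N x \<subseteq> U)"
proof -
  have "(\<exists>r>0. cantor.mball x r \<subseteq> U) \<longleftrightarrow> (\<exists>N. cylinder N x \<subseteq> U)" for x
  proof
    assume "\<exists>r>0. cantor.mball x r \<subseteq> U"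
    then obtain r where r: "r > 0" "cantor.mball x r \<subseteq> U" by blast
    obtain N where "inverse (real (Suc N)) < r"
      using reals_Archimedean[OF r(1)] by auto
    then have "cylinder (Suc N) x \<subseteq> cantor.mball x r"
      using diff_dist_less_iff[of x _ N] by force
    then show "\<exists>N. cylinder N x \<subseteq> U" using r(2) by blast
  next
    assume "\<exists>N. cylinder N x \<subseteq> U"
    then obtain N where N: "cylinder N x \<subseteq> U" by blast
    have "cantor.mball x (inverse (real (Suc N))) = cylinder (Suc N) x"
      by (simp add: set_eq_iff diff_dist_less_iff del: of_nat_Suc)
    then have "cantor.mball x (inverse (real (Suc N))) \<subseteq> U"
      using N cylinder_antimono[of N "Suc N" x] by auto
    then show "\<exists>r>0. cantor.mball x r \<subseteq> U"
      by (intro exI[of _ "inverse (real (Suc N))"]) simp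
  qed
  then show ?thesis unfolding cantor.openin_mtopology by (simp only: subset_UNIV Ball_def simp_thms)
qed

lemma openin_cantorE:
  assumes "openin cantor.mtopology U" "x \<in> U"
  obtains N where "cylinder N x \<subseteq> U"
  using assms by (auto simp only: openin_cantor_iff)

lemma clopen_cylinder:
  shows "openin cantor.mtopology (cylinder N x)" and "closedin cantor.mtopology (cylinder N x)"
proof -
  show "openin cantor.mtopology (cylinder N x)"
    unfolding openin_cantor_iff cylinder_def by (intro ballI exI[of _ N]) auto
  have "openin cantor.mtopology (- cylinder N x)"
    \<comment> \<open>The same \<open>N\<close> serves: a point agreeing below \<open>N\<close> with
      one outside the cylinder differs from \<open>x\<close> at the same index.\<close>
    unfolding openin_cantor_iff cylinder_def by (intro ballI exI[of _ N]) auto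
  then show "closedin cantor.mtopology (cylinder N x)"
    by (simp add: closedin_def Compl_eq_Diff_UNIV)
qed

lemma zero_dimensional_cantor: "zero_dimensional cantor.mtopology"
proof -
  have "\<exists>U. (closedin cantor.mtopology U \<and> openin cantor.mtopology U) \<and> x \<in> U \<and> U \<subseteq> W"
    if "openin cantor.mtopology W" "x \<in> W" for W x
  proof -
    from that obtain N where "cylinder N x \<subseteq> W" by (rule openin_cantorE)
    moreover have "x \<in> cylinder N x" by (simp add: cylinder_def)
    ultimately show ?thesis by (intro exI[of _ "cylinder N x"] conjI clopen_cylinder)
  qed
  then show ?thesis
    by (auto simp: zero_dimensional_def dimension_le_0_neighbourhood_base_of_clopen
        open_neighbourhood_base_of)
qed

text \<open>Tychonoff makes the product topology compact. Cylinders are open in it, so the identity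
  is continuous from the product onto the metric space and carries compactness over.\<close>

lemma compact_space_cantor: "compact_space cantor.mtopology"
proof -
  let ?P = "product_topology (\<lambda>_::nat. discrete_topology (UNIV::bool set)) UNIV"
  have cyl: "openin ?P (cylinder N x)" for N x
  proof -
    have eq: "cylinder N x = (\<Pi>\<^sub>E i\<in>UNIV. if i < N then {x i} else UNIV)"
      by (auto simp: cylinder_def PiE_def Pi_def split: if_splits)
    have "finite {i. (if i < N then {x i} else UNIV) \<noteq> UNIV}"
      by (rule finite_subset[of _ "{..<N}"]) auto
    then show ?thesis unfolding eq openin_PiE_gen by simp
  qed
  have "openin ?P U" if "openin cantor.mtopology U" for U
  proof (subst openin_subopen, intro ballI)
    fix x assume "x \<in> U"
    with that obtain N where "cylinder N x \<subseteq> U" by (rule openin_cantorE)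
    moreover have "x \<in> cylinder N x" by (simp add: cylinder_def)
    ultimately show "\<exists>T. openin ?P T \<and> x \<in> T \<and> T \<subseteq> U"
      by (intro exI[of _ "cylinder N x"] conjI cyl)
  qed
  then have "continuous_map ?P cantor.mtopology id"
    by (auto simp: continuous_map_def PiE_def extensional_def)
  moreover have "compactin ?P UNIV"
  proof -
    have "compact_space ?P"
      by (simp add: compact_space_product_topology compact_space_discrete_topology)
    then show ?thesis by (simp add: compact_space_def)
  qed
  ultimately have "compactin cantor.mtopology (id ` UNIV)"
    by (rule image_compactin[rotated])
  then show ?thesis by (simp add: compact_space_def)
qed

section \<open>The group of skew products\<close>

text \<open>Starting at index 1 keeps the fibre coordinate out. The bound \<open>N\<close> makes
  \<open>f\<close> a locally constant function of the base, described by finitely many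
  values.\<close>

definition base_determined :: "nat \<Rightarrow> (point \<Rightarrow> bool) \<Rightarrow> bool"
  where "base_determined N f \<longleftrightarrow> (\<forall>x y. (\<forall>i\<in>{1..N}. x i = y i) \<longrightarrow> f x = f y)"

text \<open>On \<open>bool\<close>, \<open>\<noteq>\<close> is addition modulo 2. Index 0 is
  governed by the cocycle \<open>f\<close> alone, every other index by the indicator of
  \<open>s\<close>.\<close>

definition skew :: "nat set \<Rightarrow> (point \<Rightarrow> bool) \<Rightarrow> point \<Rightarrow> point"
  where "skew s f x = (\<lambda>n. x n \<noteq> (if n = 0 then f x else n \<in> s))"

lemma skew_apply: "skew s f x n \<longleftrightarrow> x n \<noteq> (if n = 0 then f x else n \<in> s)"
  by (simp add: skew_def)

definition skews :: "(point \<Rightarrow> point) set"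
  where "skews = {skew s f | s f. finite s \<and> (\<exists>N. base_determined N f)}"

lemma skew_in_skews: "finite s \<Longrightarrow> base_determined N f \<Longrightarrow> skew s f \<in> skews"
  by (auto simp: skews_def)

lemma base_determinedD:
  assumes "base_determined N f" "\<And>i. 1 \<le> i \<Longrightarrow> i \<le> N \<Longrightarrow> x i = y i"
  shows "f x = f y"
  using assms(1)[unfolded base_determined_def, rule_format, of x y] assms(2) by simp

text \<open>\<open>skew s h\<close> shifts each base coordinate by an amount independent of the
  point, so agreement on 1, ..., N survives it, whatever \<open>h\<close> is.\<close>

lemma base_determined_skew:
  assumes "base_determined N f"
  shows "base_determined N (\<lambda>x. f (skew s h x))"
  unfolding base_determined_def
  by (intro allI impI base_determinedD[OF assms]) (auto simp: skew_apply)

lemma skew_comp_in_skews: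
  assumes "g \<in> skews" "h \<in> skews"
  shows "g \<circ> h \<in> skews"
proof -
  obtain s f M where g: "g = skew s f" "finite s" "base_determined M f"
    using assms(1) by (auto simp: skews_def)
  obtain t k N where h: "h = skew t k" "finite t" "base_determined N k"
    using assms(2) by (auto simp: skews_def)
  \<comment> \<open>The cocycle of the composition: the fibre is shifted by \<open>k x\<close> and
    then by \<open>f\<close> at the moved point. The base shifts add up to the symmetric
    difference.\<close>
  let ?k = "\<lambda>x. k x \<noteq> f (skew t k x)"
  have "g \<circ> h = skew ((s - t) \<union> (t - s)) ?k"
    by (auto simp: g(1) h(1) skew_apply fun_eq_iff)
  moreover have "base_determined (max M N) ?k"
    unfolding base_determined_def
  proof (intro allI impI)
    fix x y :: point assume "\<forall>i\<in>{1..max M N}. x i = y i"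
    then have "x i = y i" if "1 \<le> i" "i \<le> max M N" for i using that by simp
    then have "k x = k y" "f (skew t k x) = f (skew t k y)"
      by (rule base_determinedD[OF h(3)] base_determinedD[OF base_determined_skew[OF g(3)]]; simp)+
    then show "?k x = ?k y" by simp
  qed
  ultimately show ?thesis using g(2) h(2) by (simp add: skew_in_skews)
qed

lemma skews_inverse:
  assumes "g \<in> skews"
  obtains h where "h \<in> skews" "g \<circ> h = id" "h \<circ> g = id"
proof -
  obtain s f N where g: "g = skew s f" "finite s" "base_determined N f"
    using assms by (auto simp: skews_def)
  \<comment> \<open>The base shift is its own inverse. To undo the fibre shift, \<open>f\<close> has
    to be evaluated at the preimage, whose base point is that of \<open>skew s f x\<close>.\<close>
  let ?f = "\<lambda>x. f (skew s f x)"
  have "f (skew s ?f x) = f (skew s f x)" "f (skew s f (skew s f x)) = f x" for x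
    by (rule base_determinedD[OF g(3)]; auto simp: skew_apply)+
  then have "g \<circ> skew s ?f = id" "skew s ?f \<circ> g = id"
    unfolding g(1) by (auto simp: fun_eq_iff skew_apply)
  then show ?thesis
    using that skew_in_skews[OF g(2) base_determined_skew[OF g(3)]] by blast
qed

lemma continuous_map_skews:
  assumes "g \<in> skews"
  shows "continuous_map cantor.mtopology cantor.mtopology g"
proof -
  obtain s f N where g: "g = skew s f" "base_determined N f"
    using assms by (auto simp: skews_def)
  have "openin cantor.mtopology {x. g x \<in> U}" if "openin cantor.mtopology U" for U
    unfolding openin_cantor_iff
  proof
    fix x assume "x \<in> {x. g x \<in> U}"
    then have "g x \<in> U" by simp
    with that obtain M where M: "cylinder M (g x) \<subseteq> U" by (rule openin_cantorE)
    \<comment> \<open>The image coordinates below \<open>M\<close> depend on the same coordinates of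
      the point and, at index 0, on the indices up to and including \<open>N\<close>; hence
      \<open>Suc N\<close>.\<close>
    have "g y \<in> cylinder M (g x)" if "y \<in> cylinder (max M (Suc N)) x" for y
    proof -
      have "y i = x i" if "i < M \<or> i \<le> N" for i
        using that \<open>y \<in> _\<close> by (auto simp: cylinder_def)
      moreover from this have "f y = f x"
        by (intro base_determinedD[OF g(2)]) simp
      ultimately show ?thesis by (simp add: g(1) cylinder_def skew_apply)
    qed
    then show "\<exists>K. cylinder K x \<subseteq> {x. g x \<in> U}" using M by blast
  qed
  then show ?thesis by (simp add: continuous_map_def)
qed

lemma skews_subset_Homeo: "skews \<subseteq> carrier (HomeoGroup cantor.mtopology)"
proof
  fix g assume g: "g \<in> skews"
  then obtain h where h: "h \<in> skews" "g \<circ> h = id" "h \<circ> g = id" by (rule skews_inverse)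
  have "homeomorphic_maps cantor.mtopology cantor.mtopology g h"
    using h(2,3) continuous_map_skews[OF g] continuous_map_skews[OF h(1)]
    by (simp add: homeomorphic_maps_def fun_eq_iff)
  moreover have "bij g" using h(2,3) o_bij by blast
  ultimately show "g \<in> carrier (HomeoGroup cantor.mtopology)"
    by (auto simp: HomeoGroup_def Bij_def homeomorphic_map_maps)
qed

lemma HomeoGroup_mult:
  assumes "f \<in> carrier (HomeoGroup T)" "g \<in> carrier (HomeoGroup T)"
  shows "f \<otimes>\<^bsub>HomeoGroup T\<^esub> g = compose (topspace T) f g"
  using assms by (simp add: HomeoGroup_def BijGroup_def)

lemma HomeoGroup_one: "\<one>\<^bsub>HomeoGroup T\<^esub> = (\<lambda>x\<in>topspace T. x)"
  by (simp add: HomeoGroup_def BijGroup_def)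

lemma compose_UNIV: "compose UNIV f g = f \<circ> g"
  by (simp add: compose_def fun_eq_iff)

lemma subgroup_skews: "subgroup skews (HomeoGroup cantor.mtopology)"
proof -
  interpret H: group "HomeoGroup cantor.mtopology" by (rule group_HomeoGroup)
  note sub = subsetD[OF skews_subset_Homeo]
  show ?thesis
  proof (rule H.subgroupI)
    show "skews \<subseteq> carrier (HomeoGroup cantor.mtopology)" by (rule skews_subset_Homeo)
    have "skew {} (\<lambda>_. False) \<in> skews"
      by (rule skew_in_skews[where N = 0]) (auto simp: base_determined_def)
    then show "skews \<noteq> {}" by blast
  next
    fix g assume g: "g \<in> skews"
    then obtain h where h: "h \<in> skews" "h \<circ> g = id" by (rule skews_inverse)
    have "h \<otimes>\<^bsub>HomeoGroup cantor.mtopology\<^esub> g = \<one>\<^bsub>HomeoGroup cantor.mtopology\<^esub>"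
      using h(2) sub[OF g] sub[OF h(1)]
      by (simp add: HomeoGroup_mult HomeoGroup_one compose_UNIV fun_eq_iff)
    then have "inv\<^bsub>HomeoGroup cantor.mtopology\<^esub> g = h"
      using sub[OF g] sub[OF h(1)] by (rule H.inv_equality)
    then show "inv\<^bsub>HomeoGroup cantor.mtopology\<^esub> g \<in> skews" using h(1) by simp
  next
    fix g h assume "g \<in> skews" "h \<in> skews"
    then show "g \<otimes>\<^bsub>HomeoGroup cantor.mtopology\<^esub> h \<in> skews"
      by (simp add: HomeoGroup_mult sub compose_UNIV skew_comp_in_skews)
  qed
qed

text \<open>A skew product is coded by finite data: \<open>N\<close>, the finite set
  \<open>s\<close>, and the family of those subsets of {1..N} on whose indicators \<open>f\<close>
  holds.\<close>

lemma countable_skews: "countable skews"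
proof -
  let ?I = "(UNIV :: nat set) \<times> {s :: nat set. finite s} \<times> {F :: nat set set. F \<subseteq> {s. finite s} \<and> finite F}"
  let ?g = "\<lambda>(N :: nat, s, F). skew s (\<lambda>x. {i\<in>{1..N}. x i} \<in> F)"
  have "skews \<subseteq> ?g ` ?I"
  proof
    fix g assume "g \<in> skews"
    then obtain s f N where g: "g = skew s f" "finite s" "base_determined N f"
      by (auto simp: skews_def)
    define F where "F = {A. A \<subseteq> {1..N} \<and> f (\<lambda>i. i \<in> A)}"
    have "f x \<longleftrightarrow> f (\<lambda>i. i \<in> {i\<in>{1..N}. x i})" for x
      by (rule base_determinedD[OF g(3)]) simp
    then have "f = (\<lambda>x. {i\<in>{1..N}. x i} \<in> F)"
      by (auto simp: F_def fun_eq_iff)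
    moreover have "F \<subseteq> Pow {1..N}" by (auto simp: F_def)
    then have "finite F" "F \<subseteq> {s. finite s}"
      by (auto intro: finite_subset)
    ultimately show "g \<in> ?g ` ?I" using g(1,2) by (intro image_eqI[of _ _ "(N, s, F)"]) auto
  qed
  moreover have "countable {s :: nat set. finite s}"
    using countable_Collect_finite_subset[of "UNIV :: nat set"] by simp
  then have "countable ?I"
    by (intro countable_SIGMA) (auto intro: countable_Collect_finite_subset simp: conj_commute)
  ultimately show ?thesis by (meson countable_image countable_subset)
qed

section \<open>Dynamics of the skew products\<close>

text \<open>Flipping exactly the coordinates below \<open>N\<close> where \<open>x\<close> and
  \<open>y\<close> differ suffices, with a constant cocycle for index 0. This makes every orbit
  dense.\<close>

lemma skews_transitive_on_cylinders:
  obtains g where "g \<in> skews" "g x \<in> cylinder N y"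
proof
  let ?s = "{n. n < N \<and> x n \<noteq> y n}" and ?f = "\<lambda>_. x 0 \<noteq> y 0"
  show "skew ?s ?f \<in> skews"
    by (rule skew_in_skews[where N = 0]) (auto simp: base_determined_def)
  show "skew ?s ?f x \<in> cylinder N y"
    by (auto simp: skew_apply cylinder_def)
qed

text \<open>Differences of base coordinates are invariant. The fibre difference is preserved when
  the cocycle takes equal values, which the extra condition for \<open>n = 0\<close> ensures. The
  bound is uniform in \<open>g\<close>, as distality requires.\<close>

lemma skews_dist_ge:
  assumes "g \<in> skews" "x n \<noteq> y n" "n = 0 \<Longrightarrow> \<forall>i>0. x i = y i"
  shows "inverse (real (Suc n)) \<le> diff_dist (g x) (g y)"
proof (rule diff_dist_ge)
  obtain s f N where g: "g = skew s f" "base_determined N f"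
    using assms(1) by (auto simp: skews_def)
  show "g x n \<noteq> g y n"
  proof (cases "n = 0")
    case True
    then have "f x = f y" using assms(3) by (intro base_determinedD[OF g(2)]) simp
    then show ?thesis using assms(2) True by (simp add: g(1) skew_apply)
  next
    case False
    then show ?thesis using assms(2) by (auto simp: g(1) skew_apply)
  qed
qed

lemma skews_eventually_trivial:
  assumes "g \<in> skews"
  obtains N where "\<forall>x. \<forall>n\<ge>N. g x n = x n"
proof -
  obtain s f where g: "g = skew s f" "finite s" using assms by (auto simp: skews_def)
  then obtain N where "\<forall>n\<in>s. n < N" using finite_nat_set_iff_bounded by blast
  \<comment> \<open>\<open>Suc N\<close> also excludes index 0, which the cocycle may move even if
    \<open>s\<close> is empty.\<close>
  then have "\<forall>x. \<forall>n\<ge>Suc N. g x n = x n" by (auto simp: g(1) skew_apply)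
  then show ?thesis by (rule that)
qed

section \<open>Transport to a group of natural numbers, and its action\<close>

lemma group_image_group:
  assumes "group G" "inj_on f (carrier G)"
  shows "group (image_group f G)"
    and "inv_into (carrier G) f \<in> hom (image_group f G) G"
proof -
  interpret G: group G by fact
  have "f \<in> iso G (image_group f G)"
  by (rule inj_imp_image_group_iso[OF assms(2)])
  moreover show "group (image_group f G)"
    using G.inj_imp_image_group_is_group[OF assms(2)] .
  ultimately show "inv_into (carrier G) f \<in> hom (image_group f G) G"
    using G.iso_set_sym by (auto simp: iso_def)
qed

theorem proposition4p1:
  shows "\<exists>(M :: point set) (d :: point \<Rightarrow> point \<Rightarrow> real) (G :: nat monoid)
            (\<phi> :: nat \<Rightarrow> point \<Rightarrow> point).
    Metric_space M d \<and>
    compact_space (Metric_space.mtopology M d) \<and>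
    zero_dimensional (Metric_space.mtopology M d) \<and>
    group G \<and> countable (carrier G) \<and> \<not> finitely_generated_group G \<and>
    continuous_action G (Metric_space.mtopology M d) \<phi> \<and>
    minimal_action G (Metric_space.mtopology M d) \<phi> \<and>
    distal_action G M d \<phi> \<and>
    \<not> equicontinuous_action G M d \<phi>"
proof -
  let ?H = "HomeoGroup cantor.mtopology"
  define K where "K = ?H\<lparr>carrier := skews\<rparr>"
  \<comment> \<open>The skew products are numbered by \<open>e\<close>, the group law is carried
    along, and \<open>\<phi>\<close> decodes a number into the homeomorphism it stands for.\<close>
  define e where "e = to_nat_on skews"
  define G where "G = image_group e K"
  define \<phi> where "\<phi> = inv_into skews e"
  interpret H: group ?H by (rule group_HomeoGroup)
  have K: "group K" "carrier K = skews"
    unfolding K_def using H.subgroup_imp_group[OF subgroup_skews] by auto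
  have inj: "inj_on e (carrier K)"
    unfolding e_def K(2) using countable_skews by (rule inj_on_to_nat_on)
  interpret G: group G unfolding G_def using K(1) inj by (rule group_image_group)
  have carrier_G: "carrier G = e ` skews"
    by (simp add: G_def image_group_carrier K(2))
  have \<phi>_K: "\<phi> \<in> hom G K"
    using group_image_group(2)[OF K(1) inj] by (simp add: \<phi>_def G_def K(2))
  have \<phi>_skews: "\<phi> g \<in> skews" if "g \<in> carrier G" for g
    using hom_in_carrier[OF \<phi>_K that] K(2) by simp
  have \<phi>_onto: "\<exists>g\<in>carrier G. \<phi> g = h" if "h \<in> skews" for h
    using that inj by (auto simp: carrier_G \<phi>_def K(2))
  have \<phi>_H: "\<phi> \<in> hom G ?H"
    using \<phi>_K skews_subset_Homeo K(2) by (auto simp: hom_def K_def)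
  have \<phi>_mult: "\<phi> (g \<otimes>\<^bsub>G\<^esub> h) = \<phi> g \<circ> \<phi> h" if "g \<in> carrier G" "h \<in> carrier G" for g h
    using hom_mult[OF \<phi>_H that] that
    by (simp add: HomeoGroup_mult subsetD[OF skews_subset_Homeo] \<phi>_skews compose_UNIV)
  have \<phi>_one: "\<phi> \<one>\<^bsub>G\<^esub> = id"
    using hom_one[OF \<phi>_H G.is_group H.is_group] by (simp add: HomeoGroup_one fun_eq_iff)
  have "\<not> finitely_generated_group G"
    unfolding finitely_generated_group_def
  proof (intro notI, elim exE conjE)
    fix S assume S: "finite S" "S \<subseteq> carrier G" "generate G S = carrier G"
    have "\<forall>g\<in>S. \<exists>N. \<forall>x. \<forall>n\<ge>N. \<phi> g x n = x n"
      using S(2) \<phi>_skews skews_eventually_trivial by (metis subsetD)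
    then obtain N where N: "\<And>g x n. g \<in> S \<Longrightarrow> n \<ge> N g \<Longrightarrow> \<phi> g x n = x n" by metis
    \<comment> \<open>\<open>B\<close> is a coordinate that no generator moves. \<open>Suc\<close>
      keeps it positive, hence a base coordinate; inserting 0 covers empty \<open>S\<close>.\<close>
    define B where "B = Suc (Max (insert 0 (N ` S)))"
    have "N g \<le> B" if "g \<in> S" for g
      using that S(1) by (simp add: B_def le_SucI)
    then have B: "\<phi> g x B = x B" if "g \<in> S" for g x
      using N that by simp
    have "g \<in> carrier G \<and> (\<forall>x. \<phi> g x B = x B)" if "g \<in> generate G S" for g
      using that
    proof (induction rule: generate.induct)
      case one
      then show ?case by (simp add: \<phi>_one)
    next
      case (incl h)
      then show ?case using S(2) B by auto
    next
      case (inv h)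
      then have h: "h \<in> carrier G" using S(2) by auto
      \<comment> \<open>The generator \<open>h\<close> sends \<open>\<phi> (inv h) x\<close> to
        \<open>x\<close> without changing coordinate \<open>B\<close>, so the inverse does not
        change it either.\<close>
      have "\<phi> h \<circ> \<phi> (inv\<^bsub>G\<^esub> h) = \<phi> (h \<otimes>\<^bsub>G\<^esub> inv\<^bsub>G\<^esub> h)"
        using h by (intro \<phi>_mult[symmetric]) auto
      then have "\<phi> h (\<phi> (inv\<^bsub>G\<^esub> h) x) = x" for x
        using h by (simp add: \<phi>_one fun_eq_iff)
      then show ?case using h B[OF inv] by (metis G.inv_closed)
    next
      case (eng h1 h2)
      then show ?case by (simp add: \<phi>_mult)
    qed
    \<comment> \<open>This element flips coordinate \<open>B\<close>, which the whole generated
      subgroup fixes.\<close>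
    moreover have "skew {B} (\<lambda>_. False) \<in> skews"
      by (rule skew_in_skews[where N = 0]) (auto simp: base_determined_def)
    ultimately have "skew {B} (\<lambda>_. False) (\<lambda>_. False) B = False"
      using \<phi>_onto S(3) by metis
    then show False by (simp add: skew_apply B_def)
  qed
  moreover have "continuous_action G cantor.mtopology \<phi>"
    by (simp add: continuous_action_def \<phi>_H G.is_group)
  moreover have "minimal_action G cantor.mtopology \<phi>"
    unfolding minimal_action_def
  proof (intro notI, elim exE conjE)
    fix C assume C: "closedin cantor.mtopology C" "C \<noteq> {}" "C \<noteq> topspace cantor.mtopology"
      "\<forall>g\<in>carrier G. \<phi> g ` C \<subseteq> C"
    obtain x y where "x \<in> C" "y \<notin> C" using C(2,3) by auto
    have "openin cantor.mtopology (- C)"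
      using C(1) by (simp add: closedin_def Compl_eq_Diff_UNIV)
    moreover have "y \<in> - C" using \<open>y \<notin> C\<close> by simp
    \<comment> \<open>The orbit of \<open>x\<close> stays in \<open>C\<close>, yet it enters this
      cylinder around \<open>y\<close>.\<close>
    ultimately obtain N where "cylinder N y \<subseteq> - C" by (rule openin_cantorE)
    moreover obtain h where "h \<in> skews" "h x \<in> cylinder N y"
      by (rule skews_transitive_on_cylinders)
    ultimately show False using \<phi>_onto \<open>x \<in> C\<close> C(4) by blast
  qed
  moreover have "distal_action G UNIV diff_dist \<phi>"
    unfolding distal_action_def
  proof (intro ballI impI)
    fix x y :: point assume "x \<noteq> y"
    then obtain k where k: "x k \<noteq> y k" by blast
    \<comment> \<open>If the base points differ, a positive index is chosen; otherwise only the
      fibre coordinate can differ, and the condition for \<open>n = 0\<close> holds.\<close>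
    obtain n where n: "x n \<noteq> y n" "n = 0 \<Longrightarrow> \<forall>i>0. x i = y i"
    proof (cases "\<forall>i>0. x i = y i")
      case True
      then show ?thesis using k that by blast
    next
      case False
      then show ?thesis using that by (metis less_irrefl)
    qed
    have "inverse (real (Suc n)) \<le> (INF g\<in>carrier G. diff_dist (\<phi> g x) (\<phi> g y))"
      using n \<phi>_skews G.one_closed by (intro cINF_greatest skews_dist_ge) auto
    then show "0 < (INF g\<in>carrier G. diff_dist (\<phi> g x) (\<phi> g y))"
      by (rule less_le_trans[rotated]) simp
  qed
  moreover have "\<not> equicontinuous_action G UNIV diff_dist \<phi>"
  proof
    assume "equicontinuous_action G UNIV diff_dist \<phi>"
    \<comment> \<open>The value 1 is the diameter, attained by any two points with different fibre
      coordinates.\<close>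
    then obtain \<delta> where \<delta>: "\<delta> > 0" and
      equi: "\<And>x y. diff_dist x y < \<delta> \<Longrightarrow> (SUP g\<in>carrier G. diff_dist (\<phi> g x) (\<phi> g y)) < 1"
      unfolding equicontinuous_action_def by (metis UNIV_I zero_less_one)
    obtain N where N: "inverse (real (Suc N)) < \<delta>" using reals_Archimedean[OF \<delta>] by auto
    define x :: point where "x = (\<lambda>_. False)"
    \<comment> \<open>\<open>x\<close> and \<open>y\<close> first differ at index N+1, so their
      distance 1/(N+2) is below \<open>\<delta>\<close>.\<close>
    define y :: point where "y = (\<lambda>n. n = Suc N)"
    have "diff_dist x y < inverse (real (Suc N))"
      unfolding diff_dist_less_iff by (simp add: cylinder_def x_def y_def)
    then have "diff_dist x y < \<delta>" using N by linarith
    then have less: "(SUP g\<in>carrier G. diff_dist (\<phi> g x) (\<phi> g y)) < 1" by (rule equi)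
    \<comment> \<open>The cocycle reads the one coordinate where \<open>x\<close> and
      \<open>y\<close> differ and copies that difference into the fibre, at distance 1.\<close>
    let ?h = "skew {} (\<lambda>x. x (Suc N))"
    have "?h \<in> skews"
      by (rule skew_in_skews[where N = "Suc N"]) (auto simp: base_determined_def)
    then obtain g where g: "g \<in> carrier G" "\<phi> g = ?h" using \<phi>_onto by blast
    have "1 \<le> diff_dist (?h x) (?h y)"
      using diff_dist_ge[of "?h x" 0 "?h y"] by (simp add: skew_apply x_def y_def)
    \<comment> \<open>The bound 1 on the metric makes the family bounded above, so the real supremum
      dominates each member.\<close>
    also have "\<dots> \<le> (SUP g\<in>carrier G. diff_dist (\<phi> g x) (\<phi> g y))"
      unfolding g(2)[symmetric] using g(1) diff_dist_le_1
      by (intro cSUP_upper bdd_aboveI2[where M = 1]) auto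
    finally show False using less by simp
  qed
  ultimately show ?thesis
    using cantor.Metric_space_axioms compact_space_cantor zero_dimensional_cantor G.is_group
    by (intro exI[of _ UNIV] exI[of _ diff_dist] exI[of _ G] exI[of _ \<phi>]) auto
qed

end
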